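(* Let $(x_*(\cdot),u_*(\cdot))$ be an admissible process of problem (Q) (see context) with $x_*(\cdot)\in\mathscr{B}_{\rm Lip}$, and let $p(\cdot):\mathbb{R}_+\to\mathbb{R}^n$. Suppose: (a) $p(\cdot)$ is absolutely continuous on compact intervals and, for almost every $t\in\mathbb{R}_+$, $$\dot p(t)=-\varphi_x^T(t,x_*(t),u_*(t))\,p(t)+\omega(t)f_x(t,x_*(t),u_*(t)),$$ $$H(t,x_*(t),u_*(t),p(t),1)=\max_{u\in U}H(t,x_*(t),u,p(t),1);$$ moreover $p_i(0)=0$ for every $i\notin I_0$, the limit $\lim_{t\to\infty}p(t)$ exists in $\mathbb{R}^n$, and $\lim_{t\to\infty}p_i(t)=0$ for every $i\notin I_1$. (b) There is $\gamma>0$ such that for every $t\in\mathbb{R}_+$ the function $x\mapsto\mathscr{H}(t,x,p(t))$ is concave on $V_\gamma(t)=\{x\in\mathbb{R}^n:\|x-x_*(t)\|\le\gamma\}$. Then $(x_*(\cdot),u_*(\cdot))$ is a strong local minimum of problem (Q).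
   Context: $\mathbb{R}_+=[0,\infty)$, $\overline{\mathbb{R}}_+=[0,\infty]$. $W^1_\infty(\mathbb{R}_+,\mathbb{R}^n)$ is the space of bounded functions, absolutely continuous on compact intervals, with essentially bounded derivative. $L_\infty(\mathbb{R}_+,U)$ is the set of essentially bounded measurable functions with values in $U$. Problem (Q): $$J(x(\cdot),u(\cdot))=\int_0^\infty\omega(t)f(t,x(t),u(t))\,dt\to\inf,\quad \dot x(t)=\varphi(t,x(t),u(t)),\quad x(0)=x_0,\quad \lim_{t\to\infty}x(t)=x_1,\quad u(t)\in U,$$ with $\emptyset\ne U\subseteq\mathbb{R}^m$, $\omega(\cdot)\in L_1(\mathbb{R}_+,\mathbb{R}_+)$, $f:\mathbb{R}\times\mathbb{R}^n\times\mathbb{R}^m\to\mathbb{R}$, $\varphi:\mathbb{R}\times\mathbb{R}^n\times\mathbb{R}^m\to\mathbb{R}^n$. Some components of $x_0$ and $x_1$ may be left free: $I_0,I_1\subseteq\{1,\dots,n\}$ denote the sets of prescribed components, so the boundary conditions read $x_i(0)=x_{0,i}$ for $i\in I_0$ and $\lim_{t\to\infty}x_i(t)=x_{1,i}$ for $i\in I_1$, the other components being unrestricted. A process $(x(\cdot),u(\cdot))\in W^1_\infty(\mathbb{R}_+,\mathbb{R}^n)\times L_\infty(\mathbb{R}_+,U)$ is admissible if $x(\cdot)$ solves the differential equation on every finite interval in the sense of Carathéodory, the boundary conditions hold, and the Lebesgue integral $J(x(\cdot),u(\cdot))$ is finite. An admissible $(x_*(\cdot),u_*(\cdot))$ is a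 strong local minimum if there is $\varepsilon>0$ such that $J(x(\cdot),u(\cdot))\ge J(x_*(\cdot),u_*(\cdot))$ for all admissible $(x(\cdot),u(\cdot))$ with $\|x(\cdot)-x_*(\cdot)\|_\infty\le\varepsilon$. $x_*(\cdot)\in\mathscr{B}_{\rm Lip}$ means that $x_*(\cdot)\in W^1_\infty(\mathbb{R}_+,\mathbb{R}^n)$ and for every compact $U_1\subseteq\mathbb{R}^m$ there is $\gamma>0$ such that on $V_\gamma\times U_1$, $V_\gamma=\{(t,x):\|x-x_*(t)\|\le\gamma\}$, the maps $f(t,x,u)$ and $\varphi(t,x,u)$ are uniformly continuous and differentiable in $x$ with uniformly continuous $x$-derivatives. Here $t$ ranges over $\overline{\mathbb{R}}_+$; concretely, uniform continuity on the points of $V_\gamma$ with $t<\infty$ is meant with respect to a metric of the compact space $[0,\infty]$ in $t$ (e.g. $|\arctan t-\arctan s|$) and the Euclidean metric in $x,u$. Pontryagin function: $H(t,x,u,p,\lambda_0)=\langle p,\varphi(t,x,u)\rangle-\lambda_0\,\omega(t)f(t,x,u)$. Hamiltonian (normal case): $\mathscr{H}(t,x,p)=\sup_{u\in U}H(t,x,u,p,1)$. *)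

theory Defs
  imports "HOL-Analysis.Analysis"
begin

text \<open>
  Functions on \<open>[0,\<infinity>)\<close> are represented by total functions on \<^typ>\<open>real\<close> whose values at
  negative arguments are irrelevant. Almost everywhere means with respect to Lebesgue
  measure on \<open>{0..}\<close>; since the point \<open>0\<close> is negligible, two-sided derivatives may be used there.
\<close>

text \<open>
  The \<open>\<epsilon>\<close>-\<open>\<delta>\<close> definition over finite families of nonoverlapping compact subintervals
  \<open>k = {Inf k..Sup k}\<close> of \<open>{a..b}\<close>.
\<close>

definition abs_continuous_on_interval ::
    "real \<Rightarrow> real \<Rightarrow> (real \<Rightarrow> 'a::real_normed_vector) \<Rightarrow> bool" where
  "abs_continuous_on_interval a b g \<longleftrightarrow>
     (\<forall>\<epsilon>>0. \<exists>\<delta>>0. \<forall>d s. d division_of s \<and> s \<subseteq> {a..b} \<and> (\<Sum>k\<in>d. Sup k - Inf k) < \<delta>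
        \<longrightarrow> (\<Sum>k\<in>d. norm (g (Sup k) - g (Inf k))) < \<epsilon>)"

definition locally_abs_continuous :: "(real \<Rightarrow> 'a::real_normed_vector) \<Rightarrow> bool" where
  "locally_abs_continuous g \<longleftrightarrow> (\<forall>a b. 0 \<le> a \<and> a \<le> b \<longrightarrow> abs_continuous_on_interval a b g)"

definition W1_infty :: "(real \<Rightarrow> real^'n) set" where
  "W1_infty = {x. bounded (x ` {0..}) \<and> locally_abs_continuous x \<and>
     (\<exists>C. AE t in lebesgue_on {0..}. x differentiable (at t) \<and> norm (vector_derivative x (at t)) \<le> C)}"

definition L_infty :: "(real^'m) set \<Rightarrow> (real \<Rightarrow> real^'m) set" where
  "L_infty U = {u. u \<in> borel_measurable (lebesgue_on {0..}) \<and> (\<forall>t\<ge>0. u t \<in> U) \<and>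
     (\<exists>C. AE t in lebesgue_on {0..}. norm (u t) \<le> C)}"

definition sup_norm :: "(real \<Rightarrow> 'a::real_normed_vector) \<Rightarrow> real" where
  "sup_norm g = (SUP t\<in>{0..}. norm (g t))"

definition cost ::
    "(real \<Rightarrow> real) \<Rightarrow> (real \<Rightarrow> real^'n \<Rightarrow> real^'m \<Rightarrow> real) \<Rightarrow>
     (real \<Rightarrow> real^'n) \<Rightarrow> (real \<Rightarrow> real^'m) \<Rightarrow> real" where
  "cost \<omega> f x u = integral\<^sup>L (lebesgue_on {0..}) (\<lambda>t. \<omega> t * f t (x t) (u t))"

text \<open>
  The problem data are \<open>\<omega>\<close>, \<open>f\<close>, \<open>\<phi>\<close>, \<open>U\<close>, the sets \<open>I0\<close>, \<open>I1\<close> of prescribed components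
  and the boundary values \<open>x0\<close>, \<open>x1\<close>, of which only the components in \<open>I0\<close>, \<open>I1\<close> matter.
\<close>

definition admissible ::
    "(real \<Rightarrow> real) \<Rightarrow> (real \<Rightarrow> real^'n \<Rightarrow> real^'m \<Rightarrow> real) \<Rightarrow> (real \<Rightarrow> real^'n \<Rightarrow> real^'m \<Rightarrow> real^'n) \<Rightarrow>
     (real^'m) set \<Rightarrow> 'n set \<Rightarrow> real^'n \<Rightarrow> 'n set \<Rightarrow> real^'n \<Rightarrow>
     (real \<Rightarrow> real^'n) \<Rightarrow> (real \<Rightarrow> real^'m) \<Rightarrow> bool" where
  "admissible \<omega> f \<phi> U I0 x0 I1 x1 x u \<longleftrightarrow>
     x \<in> W1_infty \<and> u \<in> L_infty U \<and>
     (AE t in lebesgue_on {0..}. (x has_vector_derivative \<phi> t (x t) (u t)) (at t)) \<and>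
     (\<forall>i\<in>I0. x 0 $ i = x0 $ i) \<and>
     (\<forall>i\<in>I1. ((\<lambda>t. x t $ i) \<longlongrightarrow> x1 $ i) at_top) \<and>
     integrable (lebesgue_on {0..}) (\<lambda>t. \<omega> t * f t (x t) (u t))"

definition strong_local_minimum ::
    "(real \<Rightarrow> real) \<Rightarrow> (real \<Rightarrow> real^'n \<Rightarrow> real^'m \<Rightarrow> real) \<Rightarrow> (real \<Rightarrow> real^'n \<Rightarrow> real^'m \<Rightarrow> real^'n) \<Rightarrow>
     (real^'m) set \<Rightarrow> 'n set \<Rightarrow> real^'n \<Rightarrow> 'n set \<Rightarrow> real^'n \<Rightarrow>
     (real \<Rightarrow> real^'n) \<Rightarrow> (real \<Rightarrow> real^'m) \<Rightarrow> bool" where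
  "strong_local_minimum \<omega> f \<phi> U I0 x0 I1 x1 xs us \<longleftrightarrow>
     admissible \<omega> f \<phi> U I0 x0 I1 x1 xs us \<and>
     (\<exists>\<epsilon>>0. \<forall>x u. admissible \<omega> f \<phi> U I0 x0 I1 x1 x u \<and> sup_norm (\<lambda>t. x t - xs t) \<le> \<epsilon>
        \<longrightarrow> cost \<omega> f x u \<ge> cost \<omega> f xs us)"

definition gradient_x ::
    "(real \<Rightarrow> real^'n \<Rightarrow> real^'m \<Rightarrow> real) \<Rightarrow> real \<Rightarrow> real^'n \<Rightarrow> real^'m \<Rightarrow> real^'n" where
  "gradient_x f t x u = (\<chi> i. frechet_derivative (\<lambda>y. f t y u) (at x) (axis i 1))"

definition jacobian_x ::
    "(real \<Rightarrow> real^'n \<Rightarrow> real^'m \<Rightarrow> real^'n) \<Rightarrow> real \<Rightarrow> real^'n \<Rightarrow> real^'m \<Rightarrow> real^'n^'n" where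
  "jacobian_x \<phi> t x u = jacobian (\<lambda>y. \<phi> t y u) (at x)"

definition tube ::
    "(real \<Rightarrow> real^'n) \<Rightarrow> real \<Rightarrow> (real^'m) set \<Rightarrow> (real \<times> (real^'n) \<times> (real^'m)) set" where
  "tube xs \<gamma> U1 = {(t, x, u). t \<ge> 0 \<and> norm (x - xs t) \<le> \<gamma> \<and> u \<in> U1}"

text \<open>
  Uniform continuity for \<open>t\<close> in \<open>[0,\<infinity>]\<close>, whose topology is induced by the metric
  \<open>\<bar>arctan t - arctan s\<bar>\<close>; only points with finite \<open>t\<close> are considered.
\<close>

definition uniformly_continuous_ext_time_on ::
    "(real \<times> (real^'n) \<times> (real^'m)) set \<Rightarrow> (real \<Rightarrow> real^'n \<Rightarrow> real^'m \<Rightarrow> 'b::metric_space) \<Rightarrow> bool" where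
  "uniformly_continuous_ext_time_on S g \<longleftrightarrow>
     (\<forall>\<epsilon>>0. \<exists>\<delta>>0. \<forall>t x u s y v. (t, x, u) \<in> S \<and> (s, y, v) \<in> S \<and>
        \<bar>arctan t - arctan s\<bar> < \<delta> \<and> dist x y < \<delta> \<and> dist u v < \<delta>
        \<longrightarrow> dist (g t x u) (g s y v) < \<epsilon>)"

definition B_Lip ::
    "(real \<Rightarrow> real^'n \<Rightarrow> real^'m \<Rightarrow> real) \<Rightarrow> (real \<Rightarrow> real^'n \<Rightarrow> real^'m \<Rightarrow> real^'n) \<Rightarrow>
     (real \<Rightarrow> real^'n) set" where
  "B_Lip f \<phi> = {xs. xs \<in> W1_infty \<and>
     (\<forall>U1. compact U1 \<longrightarrow> (\<exists>\<gamma>>0.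
        uniformly_continuous_ext_time_on (tube xs \<gamma> U1) f \<and>
        uniformly_continuous_ext_time_on (tube xs \<gamma> U1) \<phi> \<and>
        (\<forall>(t, x, u)\<in>tube xs \<gamma> U1.
           (\<lambda>y. f t y u) differentiable (at x) \<and> (\<lambda>y. \<phi> t y u) differentiable (at x)) \<and>
        uniformly_continuous_ext_time_on (tube xs \<gamma> U1) (gradient_x f) \<and>
        uniformly_continuous_ext_time_on (tube xs \<gamma> U1) (jacobian_x \<phi>)))}"

definition pontryagin ::
    "(real \<Rightarrow> real) \<Rightarrow> (real \<Rightarrow> real^'n \<Rightarrow> real^'m \<Rightarrow> real) \<Rightarrow> (real \<Rightarrow> real^'n \<Rightarrow> real^'m \<Rightarrow> real^'n) \<Rightarrow>
     real \<Rightarrow> real^'n \<Rightarrow> real^'m \<Rightarrow> real^'n \<Rightarrow> real \<Rightarrow> real" where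
  "pontryagin \<omega> f \<phi> t x u p l0 = p \<bullet> \<phi> t x u - l0 * \<omega> t * f t x u"

text \<open>The supremum may be infinite when \<open>U\<close> is not compact.\<close>

definition hamiltonian ::
    "(real \<Rightarrow> real) \<Rightarrow> (real \<Rightarrow> real^'n \<Rightarrow> real^'m \<Rightarrow> real) \<Rightarrow> (real \<Rightarrow> real^'n \<Rightarrow> real^'m \<Rightarrow> real^'n) \<Rightarrow>
     (real^'m) set \<Rightarrow> real \<Rightarrow> real^'n \<Rightarrow> real^'n \<Rightarrow> ereal" where
  "hamiltonian \<omega> f \<phi> U t x p = (SUP u\<in>U. ereal (pontryagin \<omega> f \<phi> t x u p 1))"

text \<open>
  Concavity for functions with values in \<open>(-\<infinity>,\<infinity>]\<close>; the Hamiltonian is of this kind for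
  nonempty \<open>U\<close>, so no sum \<open>\<infinity> - \<infinity>\<close> occurs. For real-valued functions this is \<^const>\<open>concave_on\<close>.
\<close>

definition ereal_concave_on :: "'a::real_vector set \<Rightarrow> ('a \<Rightarrow> ereal) \<Rightarrow> bool" where
  "ereal_concave_on S h \<longleftrightarrow> convex S \<and>
     (\<forall>x\<in>S. \<forall>y\<in>S. \<forall>a\<ge>0. \<forall>b\<ge>0. a + b = 1 \<longrightarrow>
        ereal a * h x + ereal b * h y \<le> h (a *\<^sub>R x + b *\<^sub>R y))"

end

theory Submission
  imports Defs
begin

text \<open>
  Fix an admissible competitor \<open>(x, u)\<close> near \<open>xs\<close>. At \<open>xs t\<close> the concave Hamiltonian dominates the
  differentiable function \<open>y \<mapsto> H(t, y, us t, p t)\<close> and, by the maximum condition, touches it; hence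
  the derivative of that function, which is \<open>- p'(t)\<close> by the adjoint equation, is a supergradient of
  the Hamiltonian. Writing \<open>W t = p t \<bullet> (x t - xs t)\<close>, this says that almost everywhere \<open>W'\<close> is at most
  the difference of the running costs of \<open>(x, u)\<close> and \<open>(xs, us)\<close>. The function \<open>W\<close> is locally
  absolutely continuous, vanishes at \<open>0\<close> and tends to \<open>0\<close> at infinity by the boundary and transversality
  conditions, so integration over \<open>{0..}\<close> gives a nonnegative difference of costs.
\<close>

section \<open>Absolutely continuous functions on a compact interval\<close>

lemma abs_continuous_on_intervalD:
  assumes "abs_continuous_on_interval a b g" "0 < \<epsilon>"
  obtains \<delta> where "0 < \<delta>"
    "\<And>d s. \<lbrakk>d division_of s; s \<subseteq> {a..b}; (\<Sum>k\<in>d. Sup k - Inf k) < \<delta>\<rbrakk>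
       \<Longrightarrow> (\<Sum>k\<in>d. norm (g (Sup k) - g (Inf k))) < \<epsilon>"
  using assms unfolding abs_continuous_on_interval_def by meson

lemma abs_continuous_on_interval_imp_continuous_on:
  assumes "abs_continuous_on_interval a b g"
  shows "continuous_on {a..b} g"
proof (clarsimp simp: continuous_on_iff)
  fix s \<epsilon> :: real
  assume "a \<le> s" "s \<le> b" "0 < \<epsilon>"
  obtain \<delta> where "0 < \<delta>" and \<delta>: "\<And>d s. \<lbrakk>d division_of s; s \<subseteq> {a..b}; (\<Sum>k\<in>d. Sup k - Inf k) < \<delta>\<rbrakk>
       \<Longrightarrow> (\<Sum>k\<in>d. norm (g (Sup k) - g (Inf k))) < \<epsilon>"
    by (rule abs_continuous_on_intervalD[OF assms \<open>0 < \<epsilon>\<close>]) blast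
  \<comment> \<open>A single interval is a division of itself, so absolute continuity controls one
    increment at a time.\<close>
  have *: "norm (g v - g u) < \<epsilon>" if "a \<le> u" "u \<le> v" "v \<le> b" "v - u < \<delta>" for u v
    using \<delta>[of "{{u..v}}" "{u..v}"] division_of_self[of u v] that by auto
  show "\<exists>d>0. \<forall>t\<in>{a..b}. dist t s < d \<longrightarrow> dist (g t) (g s) < \<epsilon>"
  proof (intro exI conjI ballI impI)
    fix t assume "t \<in> {a..b}" "dist t s < \<delta>"
    then show "dist (g t) (g s) < \<epsilon>"
      using *[of s t] *[of t s] \<open>a \<le> s\<close> \<open>s \<le> b\<close>
      by (cases "s \<le> t") (auto simp: dist_norm norm_minus_commute)
  qed fact
qed

lemma abs_continuous_on_interval_diff:
  assumes "abs_continuous_on_interval a b g" "abs_continuous_on_interval a b h"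
  shows "abs_continuous_on_interval a b (\<lambda>t. g t - h t)"
  unfolding abs_continuous_on_interval_def
proof (intro allI impI)
  fix \<epsilon> :: real assume "0 < \<epsilon>"
  then have e2: "0 < \<epsilon> / 2" by simp
  obtain \<delta>1 where "0 < \<delta>1" and \<delta>1: "\<And>d s. \<lbrakk>d division_of s; s \<subseteq> {a..b}; (\<Sum>k\<in>d. Sup k - Inf k) < \<delta>1\<rbrakk>
       \<Longrightarrow> (\<Sum>k\<in>d. norm (g (Sup k) - g (Inf k))) < \<epsilon> / 2"
    by (rule abs_continuous_on_intervalD[OF assms(1) e2]) blast
  obtain \<delta>2 where "0 < \<delta>2" and \<delta>2: "\<And>d s. \<lbrakk>d division_of s; s \<subseteq> {a..b}; (\<Sum>k\<in>d. Sup k - Inf k) < \<delta>2\<rbrakk>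
       \<Longrightarrow> (\<Sum>k\<in>d. norm (h (Sup k) - h (Inf k))) < \<epsilon> / 2"
    by (rule abs_continuous_on_intervalD[OF assms(2) e2]) blast
  show "\<exists>\<delta>>0. \<forall>d s. d division_of s \<and> s \<subseteq> {a..b} \<and> (\<Sum>k\<in>d. Sup k - Inf k) < \<delta> \<longrightarrow>
    (\<Sum>k\<in>d. norm (g (Sup k) - h (Sup k) - (g (Inf k) - h (Inf k)))) < \<epsilon>"
  proof (intro exI[of _ "min \<delta>1 \<delta>2"] conjI allI impI; (elim conjE)?)
    fix d s assume ds: "d division_of s" "s \<subseteq> {a..b}" "(\<Sum>k\<in>d. Sup k - Inf k) < min \<delta>1 \<delta>2"
    have "(\<Sum>k\<in>d. norm (g (Sup k) - h (Sup k) - (g (Inf k) - h (Inf k))))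
      \<le> (\<Sum>k\<in>d. norm (g (Sup k) - g (Inf k)) + norm (h (Sup k) - h (Inf k)))"
      by (intro sum_mono) norm
    also have "\<dots> < \<epsilon>"
      using \<delta>1[of d s] \<delta>2[of d s] ds by (simp add: sum.distrib)
    finally show "(\<Sum>k\<in>d. norm (g (Sup k) - h (Sup k) - (g (Inf k) - h (Inf k)))) < \<epsilon>" .
  qed (use \<open>0 < \<delta>1\<close> \<open>0 < \<delta>2\<close> in simp)
qed

text \<open>Each increment of the product splits as
  \<open>(g v - g u) \<bullet> h v + g u \<bullet> (h v - h u)\<close>, and both factors are bounded
  because they are continuous on a compact interval.\<close>

lemma abs_continuous_on_interval_inner:
  fixes g h :: "real \<Rightarrow> 'a::real_inner"
  assumes "abs_continuous_on_interval a b g" "abs_continuous_on_interval a b h"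
  shows "abs_continuous_on_interval a b (\<lambda>t. g t \<bullet> h t)"
  unfolding abs_continuous_on_interval_def
proof (intro allI impI)
  fix \<epsilon> :: real assume "0 < \<epsilon>"
  have "bounded (g ` {a..b})" "bounded (h ` {a..b})"
    using assms by (auto intro!: compact_imp_bounded compact_continuous_image
        abs_continuous_on_interval_imp_continuous_on)
  then obtain B C where "0 < B" "0 < C" and B: "\<And>t. t \<in> {a..b} \<Longrightarrow> norm (g t) \<le> B"
    and C: "\<And>t. t \<in> {a..b} \<Longrightarrow> norm (h t) \<le> C"
    unfolding bounded_pos by (metis imageI)
  \<comment> \<open>The tolerance for each factor is divided by the bound of the other one, so that
    each contributes at most half of \<epsilon>.\<close>
  then have e: "0 < \<epsilon> / (2 * C)" "0 < \<epsilon> / (2 * B)" using \<open>0 < \<epsilon>\<close> by auto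
  obtain \<delta>1 where "0 < \<delta>1" and \<delta>1: "\<And>d s. \<lbrakk>d division_of s; s \<subseteq> {a..b}; (\<Sum>k\<in>d. Sup k - Inf k) < \<delta>1\<rbrakk>
       \<Longrightarrow> (\<Sum>k\<in>d. norm (g (Sup k) - g (Inf k))) < \<epsilon> / (2 * C)"
    by (rule abs_continuous_on_intervalD[OF assms(1) e(1)]) blast
  obtain \<delta>2 where "0 < \<delta>2" and \<delta>2: "\<And>d s. \<lbrakk>d division_of s; s \<subseteq> {a..b}; (\<Sum>k\<in>d. Sup k - Inf k) < \<delta>2\<rbrakk>
       \<Longrightarrow> (\<Sum>k\<in>d. norm (h (Sup k) - h (Inf k))) < \<epsilon> / (2 * B)"
    by (rule abs_continuous_on_intervalD[OF assms(2) e(2)]) blast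
  show "\<exists>\<delta>>0. \<forall>d s. d division_of s \<and> s \<subseteq> {a..b} \<and> (\<Sum>k\<in>d. Sup k - Inf k) < \<delta> \<longrightarrow>
    (\<Sum>k\<in>d. norm (g (Sup k) \<bullet> h (Sup k) - g (Inf k) \<bullet> h (Inf k))) < \<epsilon>"
  proof (intro exI[of _ "min \<delta>1 \<delta>2"] conjI allI impI; (elim conjE)?)
    fix d s assume ds: "d division_of s" "s \<subseteq> {a..b}" "(\<Sum>k\<in>d. Sup k - Inf k) < min \<delta>1 \<delta>2"
    have "(\<Sum>k\<in>d. norm (g (Sup k) \<bullet> h (Sup k) - g (Inf k) \<bullet> h (Inf k)))
      \<le> (\<Sum>k\<in>d. C * norm (g (Sup k) - g (Inf k)) + B * norm (h (Sup k) - h (Inf k)))"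
    proof (intro sum_mono)
      fix k assume "k \<in> d"
      \<comment> \<open>Members of a division are nonempty intervals, so \<open>Inf k\<close> and
        \<open>Sup k\<close> are true endpoints in \<open>{a..b}\<close>, where the bounds
        \<open>B\<close> and \<open>C\<close> apply.\<close>
      then obtain u v where "k = cbox u v" "k \<noteq> {}"
        using division_ofD(3,4)[OF ds(1)] by metis
      then have k: "k = {u..v}" "u \<le> v" by auto
      have "k \<subseteq> {a..b}" using division_ofD(2)[OF ds(1) \<open>k \<in> d\<close>] ds(2) by blast
      then have uv: "u \<in> {a..b}" "v \<in> {a..b}" using k by auto
      have "\<bar>g v \<bullet> h v - g u \<bullet> h u\<bar> = \<bar>(g v - g u) \<bullet> h v + g u \<bullet> (h v - h u)\<bar>"
        by (simp add: inner_diff_left inner_diff_right)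
      also have "\<dots> \<le> norm (g v - g u) * norm (h v) + norm (g u) * norm (h v - h u)"
        by (intro order_trans[OF abs_triangle_ineq] add_mono Cauchy_Schwarz_ineq2)
      also have "\<dots> \<le> norm (g v - g u) * C + B * norm (h v - h u)"
        by (intro add_mono mult_left_mono mult_right_mono B C uv norm_ge_zero)
      finally show "norm (g (Sup k) \<bullet> h (Sup k) - g (Inf k) \<bullet> h (Inf k))
        \<le> C * norm (g (Sup k) - g (Inf k)) + B * norm (h (Sup k) - h (Inf k))"
        using k by (simp add: mult.commute)
    qed
    also have "\<dots> = C * (\<Sum>k\<in>d. norm (g (Sup k) - g (Inf k))) + B * (\<Sum>k\<in>d. norm (h (Sup k) - h (Inf k)))"
      by (simp add: sum.distrib sum_distrib_left)
    also have "\<dots> < C * (\<epsilon> / (2 * C)) + B * (\<epsilon> / (2 * B))"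
      using \<delta>1[of d s] \<delta>2[of d s] ds \<open>0 < B\<close> \<open>0 < C\<close>
      by (intro add_strict_mono mult_strict_left_mono) auto
    also have "\<dots> = \<epsilon>" using \<open>0 < B\<close> \<open>0 < C\<close> by simp
    finally show "(\<Sum>k\<in>d. norm (g (Sup k) \<bullet> h (Sup k) - g (Inf k) \<bullet> h (Inf k))) < \<epsilon>" .
  qed (use \<open>0 < \<delta>1\<close> \<open>0 < \<delta>2\<close> in simp)
qed

section \<open>Supergradients of concave extended-real functions\<close>

text \<open>The point \<open>c\<close> lies between \<open>y\<close> and the reflected point
  \<open>c - s *\<^sub>R d\<close>. Concavity, the bound \<open>g \<le> h\<close> at the reflected
  point and equality at \<open>c\<close> bound \<open>r\<close> by \<open>g c\<close> minus a
  difference quotient of \<open>g\<close>, and \<open>s\<close> tending to \<open>0\<close> gives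
  the claim. The real number \<open>r\<close> stands in for \<open>h y\<close>, which may be
  infinite.\<close>

lemma ereal_concave_on_supergradient:
  fixes g :: "'a::real_normed_vector \<Rightarrow> real"
  assumes conc: "ereal_concave_on {x. norm (x - c) \<le> \<gamma>} h"
    and le: "\<And>x. ereal (g x) \<le> h x" and eq: "h c = ereal (g c)"
    and deriv: "(g has_derivative L) (at c)"
    and y: "norm (y - c) \<le> \<gamma>" and r: "ereal r \<le> h y"
  shows "r \<le> g c + L (y - c)"
proof -
  define d where "d = y - c"
  have upper: "r \<le> g c - (g (c - s *\<^sub>R d) - g c) / s" if s: "0 < s" "s \<le> 1" for s
  proof -
    \<comment> \<open>The restriction \<open>s \<le> 1\<close> keeps the reflected point no farther
      from \<open>c\<close> than \<open>y\<close> is, hence inside the ball of concavity.\<close>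
    have z: "norm ((c - s *\<^sub>R d) - c) \<le> \<gamma>"
      using s y mult_right_mono[of s 1 "norm d"] by (simp add: d_def)
    \<comment> \<open>The weights are \<open>s\<close> and \<open>1\<close>, normalised to sum 1;
      they balance the opposite displacements \<open>d\<close> and \<open>- s *\<^sub>R d\<close>
      from \<open>c\<close>.\<close>
    have cvx: "(s / (1 + s)) *\<^sub>R y + (1 / (1 + s)) *\<^sub>R (c - s *\<^sub>R d) = c"
    proof -
      have "(s / (1 + s)) *\<^sub>R y + (1 / (1 + s)) *\<^sub>R (c - s *\<^sub>R d)
          = (1 / (1 + s)) *\<^sub>R (s *\<^sub>R y + (c - s *\<^sub>R d))"
        by (simp add: scaleR_add_right)
      also have "s *\<^sub>R y + (c - s *\<^sub>R d) = (1 + s) *\<^sub>R c"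
        by (simp add: d_def algebra_simps)
      finally show ?thesis using s by simp
    qed
    have "ereal (s / (1 + s)) * ereal r + ereal (1 / (1 + s)) * ereal (g (c - s *\<^sub>R d))
        \<le> ereal (s / (1 + s)) * h y + ereal (1 / (1 + s)) * h (c - s *\<^sub>R d)"
      using s by (intro add_mono ereal_mult_left_mono r le) auto
    also have "\<dots> \<le> h c"
      using conc y z s unfolding ereal_concave_on_def
      by (subst cvx[symmetric]) (auto simp: add_divide_distrib[symmetric])
    finally have "s / (1 + s) * r + 1 / (1 + s) * g (c - s *\<^sub>R d) \<le> g c"
      by (simp add: eq)
    then have "(s * r + g (c - s *\<^sub>R d)) / (1 + s) \<le> g c"
      by (simp add: add_divide_distrib)
    then have "s * r + g (c - s *\<^sub>R d) \<le> (1 + s) * g c"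
      using s by (simp add: pos_divide_le_eq mult.commute)
    then show ?thesis
      using s by (simp add: field_simps)
  qed
  have "((\<lambda>s. g (c + s *\<^sub>R (- d))) has_derivative (\<lambda>s. L (s *\<^sub>R (- d)))) (at 0)"
    by (rule has_derivative_compose[of "\<lambda>s. c + s *\<^sub>R (- d)", where g = g])
      (auto intro!: derivative_eq_intros deriv)
  moreover have "(\<lambda>s. L (s *\<^sub>R (- d))) = (*) (- L d)"
    using bounded_linear.linear[OF has_derivative_bounded_linear[OF deriv]]
    by (simp add: fun_eq_iff linear_neg linear_scale)
  ultimately have "((\<lambda>s. g (c - s *\<^sub>R d)) has_real_derivative - L d) (at 0)"
    by (simp add: has_field_derivative_def)
  \<comment> \<open>The bound \<open>upper\<close> concerns positive \<open>s\<close>, so the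
    two-sided derivative is read as a right limit.\<close>
  then have "((\<lambda>s. (g (c - s *\<^sub>R d) - g c) / s) \<longlongrightarrow> - L d) (at_right 0)"
    unfolding has_field_derivative_iff by (auto intro: filterlim_mono at_within_le_at)
  then have lim: "((\<lambda>s. g c - (g (c - s *\<^sub>R d) - g c) / s) \<longlongrightarrow> g c - (- L d)) (at_right 0)"
    by (intro tendsto_intros)
  have "r \<le> g c - (- L d)"
  proof (rule tendsto_lowerbound[OF lim])
    show "\<forall>\<^sub>F s in at_right 0. r \<le> g c - (g (c - s *\<^sub>R d) - g c) / s"
      unfolding eventually_at_right_field using upper by (intro exI[of _ 1]) auto
  qed simp
  then show ?thesis by (simp add: d_def)
qed

section \<open>The fundamental theorem of calculus for absolutely continuous functions\<close>

text \<open>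
  The gauge forces the intervals tagged in \<open>N\<close> into an open set of small measure, where absolute
  continuity makes the sum of the increments of \<open>g\<close> small.
\<close>
theorem fundamental_theorem_of_calculus_abs_continuous:
  fixes g :: "real \<Rightarrow> 'a::banach"
  assumes "a \<le> b" and ac: "abs_continuous_on_interval a b g" and N: "negligible N"
    and deriv: "\<And>t. t \<in> {a..b} - N \<Longrightarrow> (g has_vector_derivative g' t) (at t within {a..b})"
  shows "(g' has_integral (g b - g a)) {a..b}"
proof -
  \<comment> \<open>With value \<open>0\<close> on \<open>N\<close>, the Riemann terms tagged there
    vanish and leave only increments of \<open>g\<close>. The change on a negligible set does not
    affect the integral.\<close>
  define w where "w t = (if t \<in> N then 0 else g' t)" for t
  have "(w has_integral (g b - g a)) (cbox a b)"
    unfolding has_integral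
  proof (intro allI impI)
    fix \<epsilon> :: real assume "0 < \<epsilon>"
    \<comment> \<open>The summand \<open>1\<close> keeps the denominator positive when
      \<open>a = b\<close>. Half of \<epsilon> is spent on tags outside \<open>N\<close>, the other
      half on tags in \<open>N\<close>.\<close>
    define e where "e = \<epsilon> / (2 * (b - a + 1))"
    have "0 < e" using \<open>0 < \<epsilon>\<close> \<open>a \<le> b\<close> by (simp add: e_def)
    have eb: "e * (b - a) \<le> \<epsilon> / 2"
      using \<open>0 < \<epsilon>\<close> \<open>a \<le> b\<close> by (simp add: e_def field_simps)
    obtain \<delta> where "0 < \<delta>" and \<delta>: "\<And>d s. \<lbrakk>d division_of s; s \<subseteq> {a..b}; (\<Sum>k\<in>d. Sup k - Inf k) < \<delta>\<rbrakk>
       \<Longrightarrow> (\<Sum>k\<in>d. norm (g (Sup k) - g (Inf k))) < \<epsilon> / 2"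
      using abs_continuous_on_intervalD[OF ac, of "\<epsilon> / 2"] \<open>0 < \<epsilon>\<close> by auto
    obtain G where "open G" "N \<subseteq> G" and mG: "G \<in> lmeasurable" "measure lebesgue G < \<delta>"
    proof -
      obtain G where G: "open G" "N \<subseteq> G" "G - N \<in> lmeasurable" "emeasure lebesgue (G - N) < ennreal \<delta>"
        using sets_lebesgue_outer_open[OF negligible_imp_sets[OF N] \<open>0 < \<delta>\<close>] .
      have *: "G = (G - N) \<union> N" using G by auto
      have "G \<in> lmeasurable"
        by (subst *) (intro fmeasurable.Un G negligible_imp_measurable N)
      moreover have "measure lebesgue G = measure lebesgue (G - N)"
        using N by (metis * G(3) fmeasurableD measure_Un_null_set negligible_iff_null_sets)
      moreover have "measure lebesgue (G - N) < \<delta>"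
        using G(3,4) \<open>0 < \<delta>\<close> by (simp add: emeasure_eq_measure2 ennreal_less_iff)
      ultimately show thesis using that G by auto
    qed
    \<comment> \<open>At points of \<open>{a..b}\<close> outside \<open>N\<close> the radius comes
      from differentiability with tolerance \<open>e\<close>; outside both sets any radius
      serves.\<close>
    have "\<exists>d>0. (t \<in> N \<longrightarrow> ball t d \<subseteq> G) \<and> (t \<in> {a..b} - N \<longrightarrow>
         (\<forall>y\<in>{a..b}. norm (y-t) < d \<longrightarrow> norm (g y - g t - (y-t) *\<^sub>R g' t) \<le> e * norm (y-t)))" for t
    proof (cases "t \<in> N")
      case True
      then show ?thesis using \<open>open G\<close> \<open>N \<subseteq> G\<close> by (meson Diff_iff openE subsetD)
    next
      case False
      show ?thesis
      proof (cases "t \<in> {a..b}")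
        case True
        with deriv[of t] False \<open>0 < e\<close> show ?thesis
          unfolding has_vector_derivative_def has_derivative_within_alt by blast
      qed (auto intro: exI[of _ 1] simp: False)
    qed
    then have "\<exists>d. \<forall>t. 0 < d t \<and> (t \<in> N \<longrightarrow> ball t (d t) \<subseteq> G) \<and> (t \<in> {a..b} - N \<longrightarrow>
         (\<forall>y\<in>{a..b}. norm (y-t) < d t \<longrightarrow> norm (g y - g t - (y-t) *\<^sub>R g' t) \<le> e * norm (y-t)))"
      by (intro choice allI)
    then obtain d where d0: "\<And>t. 0 < d t" and dN: "\<And>t. t \<in> N \<Longrightarrow> ball t (d t) \<subseteq> G"
      and d: "\<And>t y. \<lbrakk>t \<in> {a..b}; t \<notin> N; y \<in> {a..b}; norm (y-t) < d t\<rbrakk>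
                  \<Longrightarrow> norm (g y - g t - (y-t) *\<^sub>R g' t) \<le> e * norm (y-t)"
      by blast
    show "\<exists>\<gamma>. gauge \<gamma> \<and> (\<forall>D. D tagged_division_of cbox a b \<and> \<gamma> fine D \<longrightarrow>
        norm ((\<Sum>(t, k)\<in>D. measure lborel k *\<^sub>R w t) - (g b - g a)) < \<epsilon>)"
    proof (intro exI[of _ "\<lambda>t. ball t (d t)"] conjI allI impI; (elim conjE)?)
      show "gauge (\<lambda>t. ball t (d t))" using d0 gauge_ball_dependent by blast
    next
      fix D assume D: "D tagged_division_of cbox a b" and fine: "(\<lambda>t. ball t (d t)) fine D"
      have finD: "finite D" using D by blast
      define D1 where "D1 = {(t, k) \<in> D. t \<in> N}"
      define \<Delta> where "\<Delta> k = g (Sup k) - g (Inf k)" for k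
      have interval: "\<exists>u v. k = {u..v} \<and> u \<le> v \<and> u \<in> {a..b} \<and> v \<in> {a..b} \<and> t \<in> {u..v}" if tk: "(t, k) \<in> D" for t k
      proof -
        obtain u v where k: "k = cbox u v" "t \<in> k" "k \<subseteq> cbox a b"
          using tagged_division_ofD(2,3,4)[OF D tk] by auto
        then show ?thesis by (intro exI[of _ u] exI[of _ v]) auto
      qed
      have ba: "b - a = (\<Sum>(t, k)\<in>D. Sup k - Inf k)" "g b - g a = (\<Sum>(t, k)\<in>D. \<Delta> k)"
        using additive_tagged_division_1[where f = "\<lambda>x. x"] additive_tagged_division_1[where f = g]
          \<open>a \<le> b\<close> D by (auto simp: \<Delta>_def)
      have D1: "D1 tagged_partial_division_of cbox a b"
        using D unfolding D1_def tagged_division_of_def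
        by (auto intro: tagged_partial_division_subset)
      then have div: "snd ` D1 division_of \<Union>(snd ` D1)"
        by (rule partial_division_of_tagged_division)
      have sub: "\<Union>(snd ` D1) \<subseteq> {a..b}"
        using tagged_partial_division_ofD(3)[OF D1] by fastforce
      have subG: "\<Union>(snd ` D1) \<subseteq> G"
        using dN fine by (fastforce simp: D1_def fine_def)
      have ne: "k \<noteq> {}" if "(t, k) \<in> D1" for t k
        using tagged_partial_division_ofD(2)[OF D1 that] by auto
      \<comment> \<open>The intervals do not overlap, so their total length is the measure of their
        union, a subset of \<open>G\<close>, and is below \<delta>.\<close>
      have "(\<Sum>k\<in>snd ` D1. Sup k - Inf k) = (\<Sum>k\<in>snd ` D1. measure lebesgue k)"
      proof (rule sum.cong)
        fix k assume "k \<in> snd ` D1"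
        then obtain t where "(t, k) \<in> D" by (auto simp: D1_def)
        then obtain u v where "k = {u..v}" "u \<le> v"
          using interval by blast
        then show "Sup k - Inf k = measure lebesgue k" by simp
      qed simp
      also have "\<dots> = measure lebesgue (\<Union>(snd ` D1))"
        using content_division[OF div] .
      also have "\<dots> \<le> measure lebesgue G"
        using mG div by (intro measure_mono_fmeasurable subG) (auto intro: fmeasurableD lmeasurable_division)
      finally have "(\<Sum>k\<in>snd ` D1. norm (\<Delta> k)) < \<epsilon> / 2"
        unfolding \<Delta>_def using mG(2) by (intro \<delta>[OF div sub]) simp
      \<comment> \<open>Different tags may share a degenerate interval, so passing from intervals to
        tagged pairs requires a summand that vanishes on intervals with empty interior. On single
        points \<Delta> does so by itself; on the empty set, where \<open>Inf\<close> and
        \<open>Sup\<close> carry no meaning, the value \<open>0\<close> is imposed.\<close>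
      also have "(\<Sum>k\<in>snd ` D1. norm (\<Delta> k)) = (\<Sum>k\<in>snd ` D1. if k = {} then 0 else norm (\<Delta> k))"
        by (intro sum.cong) (auto dest: ne)
      also have "\<dots> = (\<Sum>(t, k)\<in>D1. if k = {} then 0 else norm (\<Delta> k))"
        by (rule sum.over_tagged_division_lemma[symmetric, OF tagged_partial_division_of_Union_self[OF D1]])
          (auto simp: \<Delta>_def)
      also have "\<dots> = (\<Sum>(t, k)\<in>D1. norm (\<Delta> k))"
        by (intro sum.cong) (auto dest: ne)
      also have "\<dots> = (\<Sum>(t, k)\<in>D. if t \<in> N then norm (\<Delta> k) else 0)"
        unfolding D1_def using finD by (intro sum.mono_neutral_cong_left) (auto split: if_splits)
      finally have bad: "(\<Sum>(t, k)\<in>D. if t \<in> N then norm (\<Delta> k) else 0) < \<epsilon> / 2" .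
      have "norm ((\<Sum>(t, k)\<in>D. measure lborel k *\<^sub>R w t) - (g b - g a))
          = norm (\<Sum>(t, k)\<in>D. measure lborel k *\<^sub>R w t - \<Delta> k)"
        by (simp add: ba(2) split_def sum_subtractf)
      also have "\<dots> \<le> (\<Sum>(t, k)\<in>D. e * (Sup k - Inf k) + (if t \<in> N then norm (\<Delta> k) else 0))"
      proof (rule sum_norm_le, clarify)
        fix t k assume tk: "(t, k) \<in> D"
        obtain u v where k: "k = {u..v}" "u \<le> v" "u \<in> {a..b}" "v \<in> {a..b}" "t \<in> {u..v}"
          using interval[OF tk] by blast
        show "norm (measure lborel k *\<^sub>R w t - \<Delta> k) \<le> e * (Sup k - Inf k) + (if t \<in> N then norm (\<Delta> k) else 0)"
        proof (cases "t \<in> N")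
          case True
          then show ?thesis using k \<open>0 < e\<close> by (simp add: w_def)
        next
          case False
          have "k \<subseteq> ball t (d t)" using fine tk by (auto simp: fine_def)
          moreover have "u \<in> k" "v \<in> k" using k by auto
          ultimately have "u \<in> ball t (d t)" "v \<in> ball t (d t)" by blast+
          then have near: "norm (u - t) < d t" "norm (v - t) < d t"
            by (auto simp: dist_real_def)
          \<comment> \<open>The increment is split at the tag. Since \<open>t\<close> lies between
            \<open>u\<close> and \<open>v\<close>, the two linearisation errors add up to at most
            \<open>e\<close> times the length of \<open>k\<close>.\<close>
          have "norm (measure lborel k *\<^sub>R w t - \<Delta> k)
              = norm (g u - g t - (u - t) *\<^sub>R g' t - (g v - g t - (v - t) *\<^sub>R g' t))"
            using False k by (simp add: w_def \<Delta>_def algebra_simps)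
          also have "\<dots> \<le> e * norm (u - t) + e * norm (v - t)"
            using k False near by (intro order_trans[OF norm_triangle_ineq4] add_mono d) auto
          also have "\<dots> = e * (Sup k - Inf k)"
            using k by (simp add: algebra_simps)
          finally show ?thesis using False by simp
        qed
      qed
      also have "\<dots> = e * (b - a) + (\<Sum>(t, k)\<in>D. if t \<in> N then norm (\<Delta> k) else 0)"
        by (simp add: ba(1) split_def sum.distrib sum_distrib_left)
      also have "\<dots> < \<epsilon>" using eb bad by simp
      finally show "norm ((\<Sum>(t, k)\<in>D. measure lborel k *\<^sub>R w t) - (g b - g a)) < \<epsilon>" .
    qed
  qed
  then show ?thesis
    using has_integral_spike[OF N, of "{a..b}" g' w] by (auto simp: w_def)
qed

section \<open>Integrals over a half-line\<close>

text \<open>Connects the gauge integrals produced by the fundamental theorem with the Lebesgue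
  integral that defines the cost. Both are rewritten as Lebesgue set integrals, which converge as
  the interval exhausts the half-line.\<close>

lemma tendsto_integral_lebesgue_on_atLeast:
  fixes F :: "real \<Rightarrow> 'a::euclidean_space"
  assumes "integrable (lebesgue_on {a..}) F"
  shows "((\<lambda>T. integral {a..T} F) \<longlongrightarrow> integral\<^sup>L (lebesgue_on {a..}) F) at_top"
proof -
  have F: "set_integrable lebesgue {a..} F"
    using assms by (simp add: set_integrable_def integrable_restrict_space)
  have "((\<lambda>T. LINT t:{a..T}|lebesgue. F t) \<longlongrightarrow> (LINT t:{a..}|lebesgue. F t)) at_top"
    by (rule tendsto_set_lebesgue_integral_at_top[OF _ F]) simp
  moreover have "(LINT t:{a..T}|lebesgue. F t) = integral {a..T} F" for T
    by (rule set_lebesgue_integral_eq_integral) (rule set_integrable_subset[OF F], auto)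
  moreover have "(LINT t:{a..}|lebesgue. F t) = integral\<^sup>L (lebesgue_on {a..}) F"
    by (simp add: set_lebesgue_integral_def integral_restrict_space)
  ultimately show ?thesis by simp
qed

section \<open>Derivative of the Pontryagin function and supergradient of the Hamiltonian\<close>

lemma frechet_derivative_eq_inner_gradient_x:
  assumes "(\<lambda>y. f t y u) differentiable (at x)"
  shows "frechet_derivative (\<lambda>y. f t y u) (at x) h = gradient_x f t x u \<bullet> h"
proof -
  let ?L = "frechet_derivative (\<lambda>y. f t y u) (at x)"
  have lin: "linear ?L" using assms by (rule linear_frechet_derivative)
  have "?L h = ?L (\<Sum>i\<in>UNIV. h $ i *\<^sub>R axis i 1)"
    using basis_expansion[of h] by (simp add: scalar_mult_eq_scaleR)
  also have "\<dots> = gradient_x f t x u \<bullet> h"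
    by (simp add: linear_sum[OF lin] linear_scale[OF lin] gradient_x_def inner_vec_def mult.commute)
  finally show ?thesis .
qed

text \<open>Transposition moves the Jacobian onto \<open>p\<close>, so that along the reference
  process the gradient is exactly minus the right-hand side of the adjoint equation.\<close>

lemma has_derivative_pontryagin:
  assumes f: "(\<lambda>y. f t y u) differentiable (at x)" and \<phi>: "(\<lambda>y. \<phi> t y u) differentiable (at x)"
  shows "((\<lambda>y. pontryagin \<omega> f \<phi> t y u p 1) has_derivative
     (\<lambda>h. (transpose (jacobian_x \<phi> t x u) *v p - \<omega> t *\<^sub>R gradient_x f t x u) \<bullet> h)) (at x)"
proof -
  have "((\<lambda>y. f t y u) has_derivative (\<lambda>h. gradient_x f t x u \<bullet> h)) (at x)"
    using frechet_derivative_works[THEN iffD1, OF f]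
    by (rule has_derivative_eq_rhs) (rule ext, rule frechet_derivative_eq_inner_gradient_x, rule f)
  moreover have "((\<lambda>y. \<phi> t y u) has_derivative (\<lambda>h. jacobian_x \<phi> t x u *v h)) (at x)"
    using \<phi> unfolding jacobian_works jacobian_x_def .
  ultimately have "((\<lambda>y. pontryagin \<omega> f \<phi> t y u p 1) has_derivative
     (\<lambda>h. p \<bullet> (jacobian_x \<phi> t x u *v h) - \<omega> t * (gradient_x f t x u \<bullet> h))) (at x)"
    unfolding pontryagin_def by (auto intro!: derivative_eq_intros)
  then show ?thesis
    by (simp add: inner_diff_left transpose_matrix_vector dot_lmul_matrix)
qed

lemma pontryagin_le_hamiltonian:
  "u \<in> U \<Longrightarrow> ereal (pontryagin \<omega> f \<phi> t x u p 1) \<le> hamiltonian \<omega> f \<phi> U t x p"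
  unfolding hamiltonian_def by (rule SUP_upper)

text \<open>The supremum is attained at \<open>v\<close>. This gives finiteness and the touching
  condition required of a supergradient.\<close>

lemma hamiltonian_eq_pontryagin:
  assumes "is_arg_max (\<lambda>u. pontryagin \<omega> f \<phi> t x u p 1) (\<lambda>u. u \<in> U) v"
  shows "hamiltonian \<omega> f \<phi> U t x p = ereal (pontryagin \<omega> f \<phi> t x v p 1)"
  using assms unfolding hamiltonian_def
  by (intro antisym SUP_least SUP_upper) (auto simp: is_arg_max_linorder)

text \<open>The touching function is the Pontryagin function with the control frozen at the
  maximiser \<open>v\<close>. The competing control \<open>u\<close> enters only through a real
  lower bound of the Hamiltonian at \<open>x\<close>, so the inequality stays among real numbers
  even where the Hamiltonian is infinite.\<close>

lemma pontryagin_le_supergradient: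
  assumes "(\<lambda>y. f t y v) differentiable (at xs)" "(\<lambda>y. \<phi> t y v) differentiable (at xs)"
    and "is_arg_max (\<lambda>u. pontryagin \<omega> f \<phi> t xs u p 1) (\<lambda>u. u \<in> U) v"
    and "ereal_concave_on {x. norm (x - xs) \<le> \<gamma>} (\<lambda>x. hamiltonian \<omega> f \<phi> U t x p)"
    and "norm (x - xs) \<le> \<gamma>" "u \<in> U"
  shows "pontryagin \<omega> f \<phi> t x u p 1 \<le> pontryagin \<omega> f \<phi> t xs v p 1
     + (transpose (jacobian_x \<phi> t xs v) *v p - \<omega> t *\<^sub>R gradient_x f t xs v) \<bullet> (x - xs)"
proof (rule ereal_concave_on_supergradient[OF assms(4)])
  show "ereal (pontryagin \<omega> f \<phi> t y v p 1) \<le> hamiltonian \<omega> f \<phi> U t y p" for y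
    using assms(3) by (intro pontryagin_le_hamiltonian) (simp add: is_arg_max_def)
  show "((\<lambda>y. pontryagin \<omega> f \<phi> t y v p 1) has_derivative
     (\<lambda>h. (transpose (jacobian_x \<phi> t xs v) *v p - \<omega> t *\<^sub>R gradient_x f t xs v) \<bullet> h)) (at xs)"
    by (rule has_derivative_pontryagin) fact+
qed (use assms in \<open>auto intro: hamiltonian_eq_pontryagin pontryagin_le_hamiltonian\<close>)

section \<open>Tools for comparing processes near the reference trajectory\<close>

text \<open>The radius in \<open>B_Lip\<close> depends on the compact control set. For a given
  control the singleton \<open>{u}\<close> is taken, and the reference trajectory lies in a tube of
  any positive radius.\<close>

lemma B_Lip_differentiable:
  assumes "xs \<in> B_Lip f \<phi>" "0 \<le> t"
  shows "(\<lambda>y. f t y u) differentiable (at (xs t))" "(\<lambda>y. \<phi> t y u) differentiable (at (xs t))"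
proof -
  obtain \<gamma> where "0 < \<gamma>" and *: "\<forall>(t, x, u)\<in>tube xs \<gamma> {u}.
           (\<lambda>y. f t y u) differentiable (at x) \<and> (\<lambda>y. \<phi> t y u) differentiable (at x)"
    using assms(1) compact_insert[OF compact_empty, of u] unfolding B_Lip_def by blast
  have "(t, xs t, u) \<in> tube xs \<gamma> {u}"
    using assms(2) \<open>0 < \<gamma>\<close> by (simp add: tube_def)
  with * show "(\<lambda>y. f t y u) differentiable (at (xs t))" "(\<lambda>y. \<phi> t y u) differentiable (at (xs t))"
    by auto
qed

text \<open>Boundedness makes the real supremum a true upper bound; the supremum of an unbounded set
  would be an unspecified value.\<close>

lemma norm_le_sup_norm:
  assumes "bounded (g ` {0..})" "0 \<le> t"
  shows "norm (g t) \<le> sup_norm g"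
  unfolding sup_norm_def
proof (rule cSUP_upper)
  show "bdd_above ((\<lambda>t. norm (g t)) ` {0..})"
    using assms(1) by (auto simp: bounded_iff bdd_above_def)
qed (use assms(2) in simp)

text \<open>The fundamental theorem supplies both the integrability and the integral of the
  derivative. Replacing \<open>w\<close> by \<open>F\<close> on \<open>N\<close> makes the
  comparison of integrands valid at every point.\<close>

lemma abs_continuous_increment_le_integral:
  fixes W F w :: "real \<Rightarrow> real"
  assumes "a \<le> b" "abs_continuous_on_interval a b W" "F integrable_on {a..b}" "negligible N"
    and "\<And>t. t \<in> {a..b} - N \<Longrightarrow> (W has_vector_derivative w t) (at t) \<and> w t \<le> F t"
  shows "W b - W a \<le> integral {a..b} F"
proof (rule has_integral_le)
  show "((\<lambda>t. if t \<in> N then F t else w t) has_integral W b - W a) {a..b}"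
    by (rule fundamental_theorem_of_calculus_abs_continuous[OF assms(1,2,4)])
      (use assms(5) in \<open>auto intro: has_vector_derivative_at_within\<close>)
  show "(F has_integral integral {a..b} F) {a..b}"
    using assms(3) by (rule integrable_integral)
qed (use assms(5) in auto)

section \<open>Sufficiency of the maximum condition under a concave Hamiltonian\<close>

theorem theorem3p9:
  fixes \<omega> :: "real \<Rightarrow> real"
    and f :: "real \<Rightarrow> real^'n \<Rightarrow> real^'m \<Rightarrow> real"
    and \<phi> :: "real \<Rightarrow> real^'n \<Rightarrow> real^'m \<Rightarrow> real^'n"
    and U :: "(real^'m) set"
    and I0 I1 :: "'n set"
    and x0 x1 :: "real^'n"
    and xs p :: "real \<Rightarrow> real^'n"
    and us :: "real \<Rightarrow> real^'m"
  assumes "U \<noteq> {}"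
    and "integrable (lebesgue_on {0..}) \<omega>" and "\<forall>t\<ge>0. \<omega> t \<ge> 0"
    and "admissible \<omega> f \<phi> U I0 x0 I1 x1 xs us"
    and "xs \<in> B_Lip f \<phi>"
    and "locally_abs_continuous p"
    and "AE t in lebesgue_on {0..}. (p has_vector_derivative
           (- (transpose (jacobian_x \<phi> t (xs t) (us t)) *v p t) + \<omega> t *\<^sub>R gradient_x f t (xs t) (us t))) (at t)"
    and "AE t in lebesgue_on {0..}.
           is_arg_max (\<lambda>u. pontryagin \<omega> f \<phi> t (xs t) u (p t) 1) (\<lambda>u. u \<in> U) (us t)"
    and "\<forall>i. i \<notin> I0 \<longrightarrow> p 0 $ i = 0"
    and "\<exists>l. (p \<longlongrightarrow> l) at_top"
    and "\<forall>i. i \<notin> I1 \<longrightarrow> ((\<lambda>t. p t $ i) \<longlongrightarrow> 0) at_top"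
    and "\<exists>\<gamma>>0. \<forall>t\<ge>0. ereal_concave_on {x. norm (x - xs t) \<le> \<gamma>} (\<lambda>x. hamiltonian \<omega> f \<phi> U t x (p t))"
  shows "strong_local_minimum \<omega> f \<phi> U I0 x0 I1 x1 xs us"
proof -
  obtain \<gamma> where "0 < \<gamma>"
    and conc: "\<And>t. 0 \<le> t \<Longrightarrow> ereal_concave_on {x. norm (x - xs t) \<le> \<gamma>} (\<lambda>x. hamiltonian \<omega> f \<phi> U t x (p t))"
    using assms(12) by blast
  obtain l where l: "(p \<longlongrightarrow> l) at_top" using assms(10) by blast
  \<comment> \<open>The radius \<gamma> of concavity serves as the radius of the strong
    minimum.\<close>
  have "cost \<omega> f xs us \<le> cost \<omega> f x u"
    if adm: "admissible \<omega> f \<phi> U I0 x0 I1 x1 x u" and near: "sup_norm (\<lambda>t. x t - xs t) \<le> \<gamma>" for x u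
  proof -
    define W where "W t = p t \<bullet> (x t - xs t)" for t
    define F where "F t = \<omega> t * f t (x t) (u t) - \<omega> t * f t (xs t) (us t)" for t
    \<comment> \<open>By the adjoint equation \<open>q\<close> is the derivative of
      \<open>p\<close>, and \<open>w\<close> below is the derivative of \<open>W\<close> given by
      the product rule.\<close>
    define q where "q t = - (transpose (jacobian_x \<phi> t (xs t) (us t)) *v p t)
      + \<omega> t *\<^sub>R gradient_x f t (xs t) (us t)" for t
    define w where "w t = p t \<bullet> (\<phi> t (x t) (u t) - \<phi> t (xs t) (us t)) + q t \<bullet> (x t - xs t)" for t
    note admD = adm[unfolded admissible_def] assms(4)[unfolded admissible_def]
    have bdd: "bounded ((\<lambda>t. x t - xs t) ` {0..})"
      using admD by (intro bounded_minus_comp) (auto simp: W1_infty_def)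
    have close: "norm (x t - xs t) \<le> \<gamma>" if "0 \<le> t" for t
      using norm_le_sup_norm[OF bdd that] near by simp
    \<comment> \<open>Concavity, closeness and membership in \<open>U\<close> hold for nonnegative
      times, so this condition is carried along with the almost-everywhere statements.\<close>
    have "AE t in lebesgue_on {0..}. 0 \<le> t"
      by (rule AE_I2) (simp add: space_restrict_space)
    moreover have "AE t in lebesgue_on {0..}. (x has_vector_derivative \<phi> t (x t) (u t)) (at t)"
      "AE t in lebesgue_on {0..}. (xs has_vector_derivative \<phi> t (xs t) (us t)) (at t)"
      using admD by auto
    ultimately have "AE t in lebesgue_on {0..}. (W has_vector_derivative w t) (at t) \<and> w t \<le> F t"
      using assms(7,8)
    proof eventually_elim
      case (elim t)
      have "(W has_vector_derivative w t) (at t)"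
        unfolding W_def w_def q_def
        by (intro bounded_bilinear.has_vector_derivative[OF bounded_bilinear_inner]
            has_vector_derivative_diff elim)
      moreover have "u t \<in> U" using admD elim by (auto simp: L_infty_def)
      \<comment> \<open>The supergradient is \<open>- q t\<close>. Collecting the terms with
        \<open>p t\<close> and \<open>q t\<close> on one side and the running costs on the other
        gives the inequality.\<close>
      then have "w t \<le> F t"
        using pontryagin_le_supergradient[OF B_Lip_differentiable[OF assms(5) elim(1)] elim(5)
            conc[OF elim(1)] close[OF elim(1)]]
        by (fastforce simp: pontryagin_def w_def q_def F_def inner_diff_right inner_diff_left inner_add_left)
      ultimately show ?case ..
    qed
    then obtain N where N: "negligible N"
      and wF: "\<And>t. t \<in> {0..} - N \<Longrightarrow> (W has_vector_derivative w t) (at t) \<and> w t \<le> F t"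
      by (auto simp: AE_restrict_space_iff eventually_ae_filter_negligible simp del: AE_conj_iff)
    have intF: "integrable (lebesgue_on {0..}) F"
      using admD unfolding F_def by (intro Bochner_Integration.integrable_diff) auto
    have "W T - W 0 \<le> integral {0..T} F" if "0 \<le> T" for T
    proof (rule abs_continuous_increment_le_integral[OF that _ _ N])
      show "abs_continuous_on_interval 0 T W"
        unfolding W_def using assms(6) admD that
        by (intro abs_continuous_on_interval_inner abs_continuous_on_interval_diff)
          (auto simp: W1_infty_def locally_abs_continuous_def)
      show "F integrable_on {0..T}"
        by (rule integrable_on_subinterval[OF integrable_on_lebesgue_on[OF intF]]) auto
    qed (use wF in auto)
    \<comment> \<open>In each component one factor vanishes: the state difference for prescribed
      indices, the adjoint variable for free ones.\<close>
    moreover have "W 0 = 0"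
      unfolding W_def inner_vec_def
    proof (intro sum.neutral ballI)
      show "p 0 $ i \<bullet> (x 0 - xs 0) $ i = 0" for i
        using admD assms(9) by (cases "i \<in> I0") auto
    qed
    ultimately have le: "\<forall>\<^sub>F T in at_top. W T \<le> integral {0..T} F"
      by (intro eventually_mono[OF eventually_ge_at_top[of "0::real"]]) simp
    \<comment> \<open>For a prescribed component the state difference tends to \<open>0\<close>
      while \<open>p\<close> converges; for a free one \<open>p\<close> tends to \<open>0\<close>
      while the state difference stays bounded by \<gamma>.\<close>
    have "((\<lambda>t. p t $ i * (x t - xs t) $ i) \<longlongrightarrow> 0) at_top" for i
    proof (cases "i \<in> I1")
      case True
      then have "((\<lambda>t. x t $ i - xs t $ i) \<longlongrightarrow> x1 $ i - x1 $ i) at_top"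
        using admD by (intro tendsto_diff) auto
      then have "((\<lambda>t. p t $ i * (x t $ i - xs t $ i)) \<longlongrightarrow> l $ i * (x1 $ i - x1 $ i)) at_top"
        by (intro tendsto_mult tendsto_vec_nth l)
      then show ?thesis by simp
    next
      case False
      then have lim: "((\<lambda>t. p t $ i) \<longlongrightarrow> 0) at_top" using assms(11) by blast
      have "norm ((x t - xs t) $ i) \<le> \<gamma>" if "0 \<le> t" for t
        using order_trans[OF Finite_Cartesian_Product.norm_nth_le close[OF that]] .
      then have "\<forall>\<^sub>F t in at_top. norm ((x t - xs t) $ i) \<le> \<gamma>"
        by (intro eventually_mono[OF eventually_ge_at_top[of "0::real"]]) simp
      then have "Bfun (\<lambda>t. (x t - xs t) $ i) at_top" by (rule BfunI)
      then show ?thesis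
        using lim by (simp add: tendsto_Zfun_iff bounded_bilinear.Zfun_prod_Bfun[OF bounded_bilinear_mult])
    qed
    then have "(W \<longlongrightarrow> 0) at_top"
      unfolding W_def inner_vec_def by (intro tendsto_null_sum) simp
    \<comment> \<open>Both sides of \<open>le\<close> have limits as \<open>T\<close> tends to
      infinity, and the inequality passes to them.\<close>
    then have "0 \<le> integral\<^sup>L (lebesgue_on {0..}) F"
      by (rule tendsto_le[OF trivial_limit_at_top_linorder tendsto_integral_lebesgue_on_atLeast[OF intF] _ le])
    also have "\<dots> = cost \<omega> f x u - cost \<omega> f xs us"
      using admD unfolding F_def cost_def by (intro Bochner_Integration.integral_diff) auto
    finally show ?thesis by simp
  qed
  then show ?thesis
    using assms(4) \<open>0 < \<gamma>\<close> unfolding strong_local_minimum_def by blast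
qed

end
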